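(* Let $G$ be a finite group. For a function $f:G\to\mathbb{C}$ and $h\in G$ let $L_h$ act on $\mathbb{C}^G$ by $L_h\big((x(g))_{g\in G}\big)=(x(h^{-1}g))_{g\in G}$, and let $$\widetilde{X}_{L,f}=\overline{\{L_h (f(g))_{g\in G}: h\in G\}}=\overline{\{(f(h^{-1}g))_{g\in G}:h\in G\}}.$$ Then $(\widetilde{X}_{L,f},(L_g)_{g\in G})$ is a Furstenberg system of $f$ for every function $f:G\to\mathbb{C}$ if and only if $G$ is a Dedekind group (i.e. every subgroup of $G$ is normal).
   Context: For a group $G$ with identity $e$, a topological dynamical $G$-system $(X,(T_g)_{g\in G})$ is a compact Hausdorff space $X$ with continuous maps $T_g:X\to X$ such that $T_{gh}=T_gT_h$ for all $g,h\in G$ and $T_e=\mathrm{id}_X$. A point $a\in X$ is transitive if $\{T_ga:g\in G\}$ is dense in $X$. For bounded $f:G\to\mathbb{C}$, a $G$-system $(X,(T_g))$ is a (topological) Furstenberg system of $f$ if there exist some $F\in C(X)$ and some transitive point $a\in X$ with $f(g)=F(T_ga)$ for all $g\in G$, and such that for any $x\ne y$ in $X$ there is $g\in G$ with $F(T_gx)\neq F(T_gy)$. (The function $F$ and the transitive point $a$ are arbitrary; they need not be the projection to the coordinate at $e$ and the point $(f(g))_{g\in G}$.) *)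

theory Defs
  imports "HOL-Analysis.Analysis" "HOL-Algebra.Coset"
begin

definition top_dyn_system ::
  "('g, 'm) monoid_scheme \<Rightarrow> 'x topology \<Rightarrow> ('g \<Rightarrow> 'x \<Rightarrow> 'x) \<Rightarrow> bool" where
  "top_dyn_system G X T \<longleftrightarrow>
     compact_space X \<and> Hausdorff_space X \<and>
     (\<forall>g\<in>carrier G. continuous_map X X (T g)) \<and>
     (\<forall>g\<in>carrier G. \<forall>h\<in>carrier G. \<forall>x\<in>topspace X. T (g \<otimes>\<^bsub>G\<^esub> h) x = T g (T h x)) \<and>
     (\<forall>x\<in>topspace X. T \<one>\<^bsub>G\<^esub> x = x)"

definition transitive_point ::
  "('g, 'm) monoid_scheme \<Rightarrow> 'x topology \<Rightarrow> ('g \<Rightarrow> 'x \<Rightarrow> 'x) \<Rightarrow> 'x \<Rightarrow> bool" where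
  "transitive_point G X T a \<longleftrightarrow>
     a \<in> topspace X \<and> X closure_of {T g a | g. g \<in> carrier G} = topspace X"

definition furstenberg_system ::
  "('g, 'm) monoid_scheme \<Rightarrow> ('g \<Rightarrow> complex) \<Rightarrow> 'x topology \<Rightarrow> ('g \<Rightarrow> 'x \<Rightarrow> 'x) \<Rightarrow> bool" where
  "furstenberg_system G f X T \<longleftrightarrow>
     bounded (f ` carrier G) \<and> top_dyn_system G X T \<and>
     (\<exists>F a. continuous_map X euclidean F \<and> transitive_point G X T a \<and>
        (\<forall>g\<in>carrier G. f g = F (T g a)) \<and>
        (\<forall>x\<in>topspace X. \<forall>y\<in>topspace X. x \<noteq> y \<longrightarrow>
           (\<exists>g\<in>carrier G. F (T g x) \<noteq> F (T g y))))"

text \<open>Points of the product space are extensional functions on the carrier, hence the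
  restrictions below.\<close>

definition function_space :: "('g, 'm) monoid_scheme \<Rightarrow> ('g \<Rightarrow> complex) topology" where
  "function_space G = product_topology (\<lambda>_. euclidean) (carrier G)"

definition left_shift ::
  "('g, 'm) monoid_scheme \<Rightarrow> 'g \<Rightarrow> ('g \<Rightarrow> complex) \<Rightarrow> 'g \<Rightarrow> complex" where
  "left_shift G h x = (\<lambda>g\<in>carrier G. x (inv\<^bsub>G\<^esub> h \<otimes>\<^bsub>G\<^esub> g))"

definition left_orbit_closure ::
  "('g, 'm) monoid_scheme \<Rightarrow> ('g \<Rightarrow> complex) \<Rightarrow> ('g \<Rightarrow> complex) topology" where
  "left_orbit_closure G f =
     subtopology (function_space G)
       (function_space G closure_of
          {left_shift G h (restrict f (carrier G)) | h. h \<in> carrier G})"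

definition dedekind_group :: "('g, 'm) monoid_scheme \<Rightarrow> bool" where
  "dedekind_group G \<longleftrightarrow> group G \<and> (\<forall>H. subgroup H G \<longrightarrow> H \<lhd> G)"

end

theory Submission
  imports Defs
begin

text \<open>
  For finite \<open>G\<close> the orbit closure is the finite discrete space of the translates \<open>L_h f\<close>. Let \<open>H\<close>
  and \<open>K\<close> be the groups of left and right periods of \<open>f\<close>. With \<open>a = L_k f\<close> the condition
  \<open>F (L_g a) = f g\<close> reads \<open>F (L_u f) = f (u k\<^sup>-\<^sup>1)\<close>; it defines a function \<open>F\<close> iff
  \<open>k H k\<^sup>-\<^sup>1 \<subseteq> K\<close>, and this \<open>F\<close> separates points iff \<open>K \<subseteq> k H k\<^sup>-\<^sup>1\<close>. In a Dedekind group \<open>H = K\<close>, so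
  \<open>k = 1\<close> works. Conversely, for a subgroup \<open>H\<close> let \<open>f\<close> be an injective function of the right coset
  \<open>H x\<close>. Its group of left periods is \<open>H\<close> and its group of right periods is the normal core of \<open>H\<close>,
  so \<open>k H k\<^sup>-\<^sup>1 \<subseteq> K\<close> forces \<open>H\<close> to be normal.
\<close>

section \<open>Groups of left and right periods\<close>

definition left_periods :: "('g, 'm) monoid_scheme \<Rightarrow> ('g \<Rightarrow> 'a) \<Rightarrow> 'g set" where
  "left_periods G f = {s \<in> carrier G. \<forall>x\<in>carrier G. f (s \<otimes>\<^bsub>G\<^esub> x) = f x}"

definition right_periods :: "('g, 'm) monoid_scheme \<Rightarrow> ('g \<Rightarrow> 'a) \<Rightarrow> 'g set" where
  "right_periods G f = {s \<in> carrier G. \<forall>x\<in>carrier G. f (x \<otimes>\<^bsub>G\<^esub> s) = f x}"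

context group
begin

lemma inv_mult_cancel [simp]:
  assumes "x \<in> carrier G" "y \<in> carrier G"
  shows "inv x \<otimes> (x \<otimes> y) = y" "x \<otimes> (inv x \<otimes> y) = y"
  using assms by (simp_all add: m_assoc [symmetric])

lemma subgroup_left_periods: "subgroup (left_periods G f) G"
proof (rule subgroupI)
  fix a assume a: "a \<in> left_periods G f"
  have "f (inv a \<otimes> x) = f x" if "x \<in> carrier G" for x
  proof -
    \<comment> \<open>Cancellation by \<open>inv_mult_cancel\<close> is switched off here so that
      the outer factor \<open>a\<close> stays visible to the period equation; the next step switches
      it on again.\<close>
    have "f (a \<otimes> (inv a \<otimes> x)) = f (inv a \<otimes> x)"
      using a that by (simp add: left_periods_def del: inv_mult_cancel)
    then show ?thesis
      using a that by (simp add: left_periods_def)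
  qed
  with a show "inv a \<in> left_periods G f"
    by (simp add: left_periods_def)
next
  have "\<one> \<in> left_periods G f"
    by (simp add: left_periods_def)
  then show "left_periods G f \<noteq> {}"
    by blast
qed (auto simp: left_periods_def m_assoc)

lemma subgroup_right_periods: "subgroup (right_periods G f) G"
proof (rule subgroupI)
  fix a assume a: "a \<in> right_periods G f"
  have "f (x \<otimes> inv a) = f x" if "x \<in> carrier G" for x
  proof -
    have "f (x \<otimes> inv a \<otimes> a) = f (x \<otimes> inv a)"
      using a that by (simp add: right_periods_def)
    then show ?thesis
      using a that by (simp add: right_periods_def m_assoc)
  qed
  with a show "inv a \<in> right_periods G f"
    by (simp add: right_periods_def)
next
  have "\<one> \<in> right_periods G f"
    by (simp add: right_periods_def)
  then show "right_periods G f \<noteq> {}"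
    by blast
qed (auto simp: right_periods_def m_assoc [symmetric])

lemma normal_if_dedekind:
  assumes "dedekind_group G" "subgroup H G"
  shows "H \<lhd> G"
  using assms by (simp only: dedekind_group_def)

text \<open>A period moves from one side to the other by conjugation:
  \<open>x \<otimes> s = (x \<otimes> s \<otimes> inv x) \<otimes> x\<close>, and normality keeps
  the conjugate a period. The reverse inclusion uses
  \<open>inv x \<otimes> s \<otimes> x\<close>.\<close>

lemma left_periods_eq_right_periods:
  assumes "dedekind_group G"
  shows "left_periods G f = right_periods G f"
proof (intro equalityI subsetI)
  have N: "left_periods G f \<lhd> G"
    by (rule normal_if_dedekind [OF assms subgroup_left_periods])
  fix s assume s: "s \<in> left_periods G f"
  have "f (x \<otimes> s) = f x" if x: "x \<in> carrier G" for x
  proof -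
    have "f (x \<otimes> s \<otimes> inv x \<otimes> x) = f x"
      using normal.inv_op_closed2 [OF N x s] x by (simp add: left_periods_def)
    then show ?thesis
      using x s by (simp add: left_periods_def m_assoc)
  qed
  with s show "s \<in> right_periods G f"
    by (simp add: left_periods_def right_periods_def)
next
  have N: "right_periods G f \<lhd> G"
    by (rule normal_if_dedekind [OF assms subgroup_right_periods])
  fix s assume s: "s \<in> right_periods G f"
  have "f (s \<otimes> x) = f x" if x: "x \<in> carrier G" for x
  proof -
    have "f (x \<otimes> (inv x \<otimes> s \<otimes> x)) = f x"
      using normal.inv_op_closed1 [OF N x s] x by (simp add: right_periods_def)
    then show ?thesis
      using x s by (simp add: right_periods_def m_assoc)
  qed
  with s show "s \<in> left_periods G f"
    by (simp add: left_periods_def right_periods_def)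
qed

section \<open>Translates and orbit closures\<close>

lemma left_shift_mult:
  assumes "g \<in> carrier G" "h \<in> carrier G"
  shows "left_shift G (g \<otimes> h) x = left_shift G g (left_shift G h x)"
  using assms by (auto simp: left_shift_def fun_eq_iff inv_mult_group m_assoc)

lemma left_shift_one:
  assumes "x \<in> extensional (carrier G)"
  shows "left_shift G \<one> x = x"
  using assms by (auto simp: left_shift_def fun_eq_iff extensional_def)

text \<open>Replacing \<open>x\<close> by \<open>u \<otimes> x\<close> turns equality of the two
  translates into invariance under \<open>inv v \<otimes> u\<close>.\<close>

lemma left_shift_eq_iff:
  assumes u: "u \<in> carrier G" and v: "v \<in> carrier G"
  shows "left_shift G u (restrict f (carrier G)) = left_shift G v (restrict f (carrier G))
    \<longleftrightarrow> inv v \<otimes> u \<in> left_periods G f" (is "?L \<longleftrightarrow> ?R")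
proof -
  have "?L \<longleftrightarrow> (\<forall>x\<in>carrier G. f (inv u \<otimes> x) = f (inv v \<otimes> x))"
    using u v by (auto simp: left_shift_def fun_eq_iff)
  also have "\<dots> \<longleftrightarrow> (\<forall>x\<in>carrier G. f (inv v \<otimes> u \<otimes> x) = f x)"
  proof safe
    fix x assume *: "\<forall>x\<in>carrier G. f (inv u \<otimes> x) = f (inv v \<otimes> x)" and x: "x \<in> carrier G"
    show "f (inv v \<otimes> u \<otimes> x) = f x"
      using bspec [OF *, of "u \<otimes> x"] u v x by (simp add: m_assoc)
  next
    fix x assume *: "\<forall>x\<in>carrier G. f (inv v \<otimes> u \<otimes> x) = f x" and x: "x \<in> carrier G"
    show "f (inv u \<otimes> x) = f (inv v \<otimes> x)"
      using bspec [OF *, of "inv u \<otimes> x"] u v x by (simp add: m_assoc)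
  qed
  also have "\<dots> \<longleftrightarrow> ?R"
    using u v by (simp add: left_periods_def)
  finally show ?thesis .
qed

text \<open>Mirror image of \<open>left_shift_eq_iff\<close>. Once the two period groups agree, both
  criteria coincide, which ties the points of the orbit to the values of \<open>f\<close>.\<close>

lemma right_translate_eq_iff:
  assumes u: "u \<in> carrier G" and v: "v \<in> carrier G"
  shows "(\<forall>x\<in>carrier G. f (x \<otimes> u) = f (x \<otimes> v)) \<longleftrightarrow> inv v \<otimes> u \<in> right_periods G f"
proof safe
  assume *: "\<forall>x\<in>carrier G. f (x \<otimes> u) = f (x \<otimes> v)"
  have "f (x \<otimes> (inv v \<otimes> u)) = f x" if "x \<in> carrier G" for x
    using bspec [OF *, of "x \<otimes> inv v"] u v that by (simp add: m_assoc)
  then show "inv v \<otimes> u \<in> right_periods G f"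
    using u v by (simp add: right_periods_def)
next
  fix x assume *: "inv v \<otimes> u \<in> right_periods G f" and x: "x \<in> carrier G"
  then have "f (x \<otimes> v \<otimes> (inv v \<otimes> u)) = f (x \<otimes> v)"
    using v by (simp add: right_periods_def)
  then show "f (x \<otimes> u) = f (x \<otimes> v)"
    using u v x by (simp add: m_assoc)
qed

text \<open>In a Hausdorff space a finite set is closed and its subspace topology is
  discrete.\<close>

lemma left_orbit_closure_finite:
  assumes "finite (carrier G)"
  shows "left_orbit_closure G f = discrete_topology
    ((\<lambda>h. left_shift G h (restrict f (carrier G))) ` carrier G)"
proof -
  define S where "S = (\<lambda>h. left_shift G h (restrict f (carrier G))) ` carrier G"
  have "finite S"
    using assms by (simp add: S_def)
  have S: "S \<subseteq> topspace (function_space G)"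
    by (auto simp: S_def function_space_def left_shift_def)
  have H: "Hausdorff_space (function_space G)"
    by (simp add: function_space_def Hausdorff_space_product_topology)
  then have "function_space G closure_of S = S"
    using \<open>finite S\<close> S by (intro closure_of_closedin closedin_Hausdorff_finite)
  then have "left_orbit_closure G f = subtopology (function_space G) S"
    by (simp add: left_orbit_closure_def S_def Setcompr_eq_image)
  moreover have "subtopology (function_space G) S = discrete_topology S"
    using \<open>finite S\<close> S H
    by (intro finite_t1_space_imp_discrete_topology Hausdorff_imp_t1_space
        Hausdorff_space_subtopology) auto
  ultimately show ?thesis
    by (simp add: S_def)
qed

section \<open>From Dedekind groups to Furstenberg systems\<close>

lemma furstenberg_system_of_dedekind:
  assumes fin: "finite (carrier G)" and ded: "dedekind_group G"
  shows "furstenberg_system G f (left_orbit_closure G f) (left_shift G)"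
proof -
  define L where "L h = left_shift G h (restrict f (carrier G))" for h
  define X where "X = left_orbit_closure G f"
  have X: "X = discrete_topology (L ` carrier G)"
    using left_orbit_closure_finite [OF fin] by (simp add: X_def L_def [abs_def])
  have shift_L: "left_shift G g (L h) = L (g \<otimes> h)" if "g \<in> carrier G" "h \<in> carrier G" for g h
    using that by (simp add: L_def left_shift_mult)
  \<comment> \<open>The Dedekind property enters here. The forward direction at
    \<open>x = \<one>\<close> makes \<open>F\<close> well defined; the backward direction makes
    \<open>F\<close> separate points.\<close>
  have L_eq: "L u = L v \<longleftrightarrow> (\<forall>x\<in>carrier G. f (x \<otimes> u) = f (x \<otimes> v))"
    if "u \<in> carrier G" "v \<in> carrier G" for u v
    using that
    by (simp add: L_def left_shift_eq_iff right_translate_eq_iff left_periods_eq_right_periods [OF ded])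
  \<comment> \<open>\<open>inv_into\<close> picks an arbitrary \<open>u\<close> with
    \<open>L u = y\<close>; \<open>F_L\<close> shows that the choice does not affect the
    value.\<close>
  define F where "F y = f (inv_into (carrier G) L y)" for y
  have F_L: "F (L u) = f u" if u: "u \<in> carrier G" for u
  proof -
    let ?v = "inv_into (carrier G) L (L u)"
    have v: "?v \<in> carrier G" "L ?v = L u"
      using u by (auto intro: inv_into_into f_inv_into_f)
    then have "f (\<one> \<otimes> ?v) = f (\<one> \<otimes> u)"
      using L_eq u by blast
    then show ?thesis
      using u v by (simp add: F_def)
  qed
  have "top_dyn_system G X (left_shift G)"
    unfolding top_dyn_system_def
  proof (intro conjI ballI)
    show "compact_space X"
      using fin by (simp add: X compact_space_discrete_topology)
    show "left_shift G \<one> x = x" if "x \<in> topspace X" for x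
      using that by (auto simp: X shift_L)
  qed (auto simp: X shift_L left_shift_mult)
  moreover have "transitive_point G X (left_shift G) (L \<one>)"
  proof -
    have "{left_shift G g (L \<one>) | g. g \<in> carrier G} = L ` carrier G"
      by (force simp: shift_L)
    then show ?thesis
      by (simp add: transitive_point_def X discrete_topology_closure_of)
  qed
  moreover have "\<exists>g\<in>carrier G. F (left_shift G g x) \<noteq> F (left_shift G g y)"
    if "x \<in> topspace X" "y \<in> topspace X" "x \<noteq> y" for x y
    using that by (auto simp: X shift_L F_L L_eq)
  moreover have "bounded (f ` carrier G)"
    using fin by (simp add: finite_imp_bounded)
  moreover have "continuous_map X euclidean F"
    by (simp add: X)
  moreover have "\<forall>g\<in>carrier G. f g = F (left_shift G g (L \<one>))"
    by (simp add: shift_L F_L)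
  ultimately show ?thesis
    unfolding furstenberg_system_def X_def by blast
qed

section \<open>From Furstenberg systems to normality\<close>

text \<open>If the transitive point is \<open>L k\<close>, then \<open>f g\<close> depends only on
  \<open>L (g \<otimes> k)\<close>. A left period \<open>s\<close> satisfies
  \<open>L (x \<otimes> k \<otimes> s) = L (x \<otimes> k)\<close>, and
  \<open>k \<otimes> s = (k \<otimes> s \<otimes> inv k) \<otimes> k\<close>.\<close>

lemma furstenberg_system_conjugate_left_period:
  assumes fin: "finite (carrier G)"
    and furst: "furstenberg_system G f (left_orbit_closure G f) (left_shift G)"
  obtains k where "k \<in> carrier G"
    "\<And>s. s \<in> left_periods G f \<Longrightarrow> k \<otimes> s \<otimes> inv k \<in> right_periods G f"
proof -
  define L where "L h = left_shift G h (restrict f (carrier G))" for h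
  obtain F a where a: "a \<in> topspace (left_orbit_closure G f)"
    and Fa: "\<forall>g\<in>carrier G. f g = F (left_shift G g a)"
    using furst by (auto simp only: furstenberg_system_def transitive_point_def)
  \<comment> \<open>The finite orbit is already closed, so the transitive point is itself a
    translate.\<close>
  obtain k where k: "k \<in> carrier G" and a_eq: "a = L k"
    using a left_orbit_closure_finite [OF fin] by (auto simp: L_def)
  have f_eq: "f g = F (L (g \<otimes> k))" if "g \<in> carrier G" for g
    using Fa that k by (simp add: a_eq L_def left_shift_mult)
  have "k \<otimes> s \<otimes> inv k \<in> right_periods G f" if s: "s \<in> left_periods G f" for s
  proof -
    have sG: "s \<in> carrier G"
      using s by (simp add: left_periods_def)
    have "f (x \<otimes> (k \<otimes> s \<otimes> inv k)) = f x" if x: "x \<in> carrier G" for x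
    proof -
      have "inv (x \<otimes> k) \<otimes> (x \<otimes> k \<otimes> s) = s"
        using x k sG by simp
      then have "L (x \<otimes> k \<otimes> s) = L (x \<otimes> k)"
        using x k s sG by (simp add: L_def left_shift_eq_iff)
      then have "F (L (x \<otimes> (k \<otimes> s \<otimes> inv k) \<otimes> k)) = F (L (x \<otimes> k))"
        using x k sG by (simp add: m_assoc)
      then show ?thesis
        using x k sG f_eq [of x] f_eq [of "x \<otimes> (k \<otimes> s \<otimes> inv k)"] by simp
    qed
    then show ?thesis
      using k sG by (simp add: right_periods_def)
  qed
  with k show thesis
    by (rule that)
qed

text \<open>For an \<open>f\<close> that distinguishes the right cosets of \<open>H\<close>, a right
  period \<open>t\<close> satisfies \<open>H #> (y \<otimes> t) = H #> y\<close> for all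
  \<open>y\<close>. Conjugates by \<open>k\<close> of elements of \<open>H\<close> are such
  periods.\<close>

lemma normal_if_furstenberg_system:
  assumes fin: "finite (carrier G)"
    and furst: "\<And>f :: 'a \<Rightarrow> complex.
      furstenberg_system G f (left_orbit_closure G f) (left_shift G)"
    and H: "subgroup H G"
  shows "H \<lhd> G"
proof -
  have HG: "H \<subseteq> carrier G"
    using H by (rule subgroup.subset)
  have "finite (rcosets H)"
    using fin by (simp add: RCOSETS_def)
  \<comment> \<open>The finitely many cosets are numbered so that complex values can encode
    them.\<close>
  then obtain c :: "'a set \<Rightarrow> nat" where c: "inj_on c (rcosets H)"
    using finite_imp_inj_to_nat_seg by blast
  define f where "f x = complex_of_nat (c (H #> x))" for x
  have f_eq: "f x = f y \<longleftrightarrow> H #> x = H #> y" if "x \<in> carrier G" "y \<in> carrier G" for x y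
    using inj_on_eq_iff [OF c] that HG by (simp add: f_def rcosetsI)
  have left: "s \<in> left_periods G f" if s: "s \<in> H" for s
  proof -
    have "H #> (s \<otimes> x) = H #> x" if "x \<in> carrier G" for x
      using s that HG H coset_mult_assoc [of H s x] coset_join2 [of s H] by auto
    then show ?thesis
      using s HG by (auto simp: left_periods_def f_def)
  qed
  obtain k where k: "k \<in> carrier G"
    and conj: "\<And>s. s \<in> left_periods G f \<Longrightarrow> k \<otimes> s \<otimes> inv k \<in> right_periods G f"
    using furstenberg_system_conjugate_left_period [OF fin furst] by blast
  show ?thesis
    unfolding normal_inv_iff
  proof (intro conjI ballI)
    fix x s assume x: "x \<in> carrier G" and s: "s \<in> H"
    have sG: "s \<in> carrier G"
      using s HG by blast
    \<comment> \<open>Evaluating at this point absorbs the unknown \<open>k\<close>: \<open>?v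
      \<otimes> (k \<otimes> s \<otimes> inv k) = x \<otimes> s \<otimes> inv k\<close>, and the
      last factor cancels later.\<close>
    let ?v = "x \<otimes> inv k"
    have "f (?v \<otimes> (k \<otimes> s \<otimes> inv k)) = f ?v"
      using conj [OF left [OF s]] x k by (simp add: right_periods_def)
    then have "H #> (x \<otimes> s \<otimes> inv k) = H #> (x \<otimes> inv k)"
      using x k sG by (simp add: f_eq m_assoc)
    then have "x \<otimes> s \<otimes> inv k \<in> H #> (x \<otimes> inv k)"
      using rcos_self [OF _ H, of "x \<otimes> s \<otimes> inv k"] x k sG by simp
    then obtain h where h: "h \<in> H" "x \<otimes> s \<otimes> inv k = h \<otimes> (x \<otimes> inv k)"
      by (auto simp: r_coset_def)
    have hG: "h \<in> carrier G"
      using h(1) HG by blast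
    have "(x \<otimes> s) \<otimes> inv k = (h \<otimes> x) \<otimes> inv k"
      using h(2) x k hG by (simp add: m_assoc)
    then have "x \<otimes> s = h \<otimes> x"
      using x k sG hG by simp
    then have "x \<otimes> s \<otimes> inv x = h"
      using x hG by (simp add: m_assoc)
    with h show "x \<otimes> s \<otimes> inv x \<in> H"
      by simp
  qed (rule H)
qed

end

theorem proposition1p3:
  fixes G :: "('g, 'm) monoid_scheme"
  assumes "group G" and "finite (carrier G)"
  shows "(\<forall>f :: 'g \<Rightarrow> complex. furstenberg_system G f (left_orbit_closure G f) (left_shift G))
           \<longleftrightarrow> dedekind_group G"
proof -
  interpret group G by fact
  show ?thesis
    using furstenberg_system_of_dedekind [OF assms(2)] normal_if_furstenberg_system [OF assms(2)]
      assms(1)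
    unfolding dedekind_group_def by blast
qed

end
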